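(* For each integer $k\geq 2$ there is $M>0$ such that for any $k$ distinct $b_1,\dots,b_k\in\mathbb{Z}[i]$ with $N(b_j)\geq M$ for all $j$, and any choice of digit sets $D_j\subset D_{b_j}$ with $\#D_j=N(b_j)-1$ (one missing digit), there is a finite set $B\subset\mathbb{Z}[i]$ such that there are infinitely many $z\in\mathbb{Z}[i]$ with the property that for every $j\in\{1,\dots,k\}$ there is $s_j\in B$ such that $z+s_j$ has digits in $D_j$ in base $b_j$, i.e. $z+s_j=\sum_{l=0}^{m}r_lb_j^l$ for some $m\geq0$ and $r_l\in D_j$.
   Context: For $b\in\mathbb{Z}[i]$, $N(b)=|b|^2$. The digit set $D_b$ is the set of Gaussian integers in the half-open square $\{sb+t\,ib: s,t\in[0,1)\}$, a fundamental domain of the lattice $b\mathbb{Z}[i]$; it has $N(b)$ elements. *)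

theory Defs
  imports "HOL-Analysis.Analysis"
begin

definition gauss_ints :: "complex set" where
  "gauss_ints = {z. Re z \<in> \<int> \<and> Im z \<in> \<int>}"

definition gauss_norm :: "complex \<Rightarrow> real" where
  "gauss_norm b = (cmod b)\<^sup>2"

definition digit_set :: "complex \<Rightarrow> complex set" where
  "digit_set b = {z \<in> gauss_ints. \<exists>s t :: real.
     s \<in> {0..<1} \<and> t \<in> {0..<1} \<and> z = of_real s * b + of_real t * (\<i> * b)}"

(* The digit 0 need not lie in D, and the leading digit r m may be 0. *)
definition has_digits_in :: "complex set \<Rightarrow> complex \<Rightarrow> complex \<Rightarrow> bool" where
  "has_digits_in D b z \<longleftrightarrow>
     (\<exists>(m::nat) (r :: nat \<Rightarrow> complex). (\<forall>l\<le>m. r l \<in> D) \<and> z = (\<Sum>l=0..m. r l * b ^ l))"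

end

theory Submission imports Defs begin

text \<open>
  For a Gaussian integer $z$ and a base $b$, subtracting from $z / b^n$ its coordinatewise floor
  $q_n$ leaves a point $w_n$ of the unit square, and the digits of $z$ are
  $r_n = q_n - b q_{n+1}$, so that $r_n / b = w_{n+1} - w_n / b$. Hence all digits avoid the
  missing digit $d$ as soon as the real and imaginary parts of $z / b^n$, and the real part of
  $z / b^n - d / b$, stay at distance at least $2 / |b|$ from the integers.
  In the $z$-plane this removes three families of parallel strips of half-width $2 |b|^{n-1}$
  and spacing $|b|^n$. A disc of radius $L$, with $L$ of the order of $|b|^{n-1}$, meets at
  most one strip of each family, and if a disc is reduced to a quarter of its radius it can be
  moved off any one thin strip. Processing the pairs $(j, n)$ by decreasing scale therefore gives
  nested discs that shrink by a factor $4^{3k}$ per step, and when the bases are larger than a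
  constant depending on $k$, each base contributes at most one $n$ to every step.
  The discs can be started at arbitrarily large scales: simultaneous Dirichlet approximation
  gives exponents with all $b_j^{m_j}$ close to a common large real number $X$, so that the
  squares spanned by $b_j^{m_j}$ and $i b_j^{m_j}$ nearly coincide.
  The resulting $z$ needs no correction, i.e. $B = \{0\}$ works.
\<close>

section \<open>Gaussian integers and the size of digit sets\<close>

lemma gauss_ints_arith:
  assumes "x \<in> gauss_ints" "y \<in> gauss_ints"
  shows "x + y \<in> gauss_ints" "x - y \<in> gauss_ints" "x * y \<in> gauss_ints" "cnj x \<in> gauss_ints"
  using assms by (auto simp: gauss_ints_def)

lemma small_gauss_int_eq_0:
  assumes "z \<in> gauss_ints" "\<bar>Re z\<bar> < 1" "\<bar>Im z\<bar> < 1"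
  shows "z = 0"
  using assms by (intro complex_eqI) (auto simp: gauss_ints_def dest: Ints_nonzero_abs_less1)

lemma gauss_norm_Ints: "b \<in> gauss_ints \<Longrightarrow> gauss_norm b \<in> \<int>"
  by (auto simp: gauss_ints_def gauss_norm_def cmod_power2)

lemma digit_set_iff:
  assumes "b \<noteq> 0"
  shows "z \<in> digit_set b \<longleftrightarrow>
    z \<in> gauss_ints \<and> Re (z / b) \<in> {0..<1} \<and> Im (z / b) \<in> {0..<1}"
proof -
  have "z = of_real s * b + of_real t * (\<i> * b) \<longleftrightarrow> s = Re (z / b) \<and> t = Im (z / b)" for s t
  proof -
    have "z = of_real s * b + of_real t * (\<i> * b) \<longleftrightarrow> z / b = Complex s t"
      using assms by (simp add: field_simps Complex_eq)
    then show ?thesis by (auto simp: complex_eq_iff)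
  qed
  then show ?thesis by (auto simp: digit_set_def)
qed

lemma digit_set_inj_mod:
  assumes "b \<noteq> 0" "f \<in> digit_set b" "g \<in> digit_set b" "h \<in> gauss_ints" "f - g = b * h"
  shows "f = g"
proof -
  have "h = f / b - g / b" using assms by (simp add: field_simps)
  then have "\<bar>Re h\<bar> < 1" "\<bar>Im h\<bar> < 1"
    using assms by (auto simp: digit_set_iff)
  then have "h = 0" using assms small_gauss_int_eq_0 by blast
  then show ?thesis using assms by simp
qed

text \<open>Squaring avoids counting lattice points in a tilted square: pairs of digits inject into
  pairs of residues mod \<open>N\<close>, so the square of \<open>card F\<close> is at most that of
  \<open>N\<close>.\<close>

lemma card_digit_set_le:
  assumes b: "b \<in> gauss_ints" "b \<noteq> 0" and F: "finite F" "F \<subseteq> digit_set b"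
  shows "real (card F) \<le> gauss_norm b"
proof -
  obtain N :: int where N: "gauss_norm b = of_int N"
    using gauss_norm_Ints[OF b(1)] by (auto elim: Ints_cases)
  have "0 < gauss_norm b" using b by (simp add: gauss_norm_def)
  then have N_pos: "0 < N" using N by simp
  have NC: "complex_of_int N = b * cnj b"
    using complex_norm_square[of b] unfolding gauss_norm_def[symmetric] N by simp
  define \<phi> where "\<phi> = (\<lambda>(f, g). let z = f + b * cnj g in (\<lfloor>Re z\<rfloor> mod N, \<lfloor>Im z\<rfloor> mod N))"
  have FG: "f \<in> gauss_ints" if "f \<in> F" for f
    using that F by (auto simp: digit_set_def)
  \<comment> \<open>As \<open>N = b * cnj b\<close>, reduction mod \<open>b\<close> recovers \<open>f\<close>, and then dividing by \<open>b\<close> and conjugating recovers \<open>g\<close>.\<close>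
  have "inj_on \<phi> (F \<times> F)"
  proof (rule inj_onI, clarify)
    fix f g f' g' assume *: "f \<in> F" "g \<in> F" "f' \<in> F" "g' \<in> F" "\<phi> (f, g) = \<phi> (f', g')"
    define z z' where "z = f + b * cnj g" and "z' = f' + b * cnj g'"
    have zG: "z \<in> gauss_ints" "z' \<in> gauss_ints"
      unfolding z_def z'_def using * FG b by (auto intro!: gauss_ints_arith)
    have "N dvd \<lfloor>Re z\<rfloor> - \<lfloor>Re z'\<rfloor>" "N dvd \<lfloor>Im z\<rfloor> - \<lfloor>Im z'\<rfloor>"
      using *(5) by (auto simp: \<phi>_def Let_def z_def z'_def mod_eq_dvd_iff)
    then obtain p q where pq: "\<lfloor>Re z\<rfloor> - \<lfloor>Re z'\<rfloor> = N * p" "\<lfloor>Im z\<rfloor> - \<lfloor>Im z'\<rfloor> = N * q"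
      by (auto elim!: dvdE)
    define h where "h = Complex (of_int p) (of_int q)"
    have hG: "h \<in> gauss_ints" by (simp add: h_def gauss_ints_def)
    have fl: "Re z = of_int \<lfloor>Re z\<rfloor>" "Im z = of_int \<lfloor>Im z\<rfloor>"
      "Re z' = of_int \<lfloor>Re z'\<rfloor>" "Im z' = of_int \<lfloor>Im z'\<rfloor>"
      using zG by (auto simp: gauss_ints_def elim!: Ints_cases)
    have "Re (z - z') = of_int (N * p)" "Im (z - z') = of_int (N * q)"
      using fl by (simp_all flip: pq)
    then have "z - z' = b * cnj b * h"
      unfolding NC[symmetric] by (simp add: complex_eq_iff h_def)
    then have eq: "f - f' = b * (cnj b * h - (cnj g - cnj g'))"
      by (simp add: z_def z'_def algebra_simps)
    have "cnj b * h - (cnj g - cnj g') \<in> gauss_ints"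
      using * FG b hG by (auto intro!: gauss_ints_arith)
    then have ff: "f = f'" using digit_set_inj_mod b * F eq by blast
    then have "cnj (g - g') = cnj (b * cnj h)" using eq b by simp
    then have "g - g' = b * cnj h" using complex_cnj_cancel_iff by blast
    then have "g = g'" using digit_set_inj_mod b * F hG gauss_ints_arith(4) by blast
    with ff show "f = f' \<and> g = g'" by simp
  qed
  moreover have "\<phi> ` (F \<times> F) \<subseteq> {0..<N} \<times> {0..<N}"
    using N_pos by (auto simp: \<phi>_def Let_def)
  ultimately have "card (F \<times> F) \<le> card ({0..<N} \<times> {0..<N})"
    by (meson card_inj_on_le finite_SigmaI finite_atLeastLessThan_int)
  then have "(card F)\<^sup>2 \<le> (nat N)\<^sup>2" by (simp add: card_cartesian_product power2_eq_square)
  then have "card F \<le> nat N" by (simp add: power2_nat_le_eq_le)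
  then show ?thesis using N N_pos by linarith
qed

text \<open>If two digits were missing, putting both back into \<open>D\<close> would give
  \<open>gauss_norm b + 1\<close> digits, contradicting \<open>card_digit_set_le\<close>.\<close>

lemma missing_digit:
  assumes b: "b \<in> gauss_ints" "1 < gauss_norm b"
    and D: "D \<subseteq> digit_set b" "real (card D) = gauss_norm b - 1"
  shows "\<exists>d. digit_set b - {d} \<subseteq> D"
proof (rule ccontr)
  assume *: "\<not> ?thesis"
  then obtain d where d: "d \<in> digit_set b" "d \<notin> D" by blast
  obtain e where e: "e \<in> digit_set b" "e \<noteq> d" "e \<notin> D" using * by blast
  \<comment> \<open>\<open>card\<close> is 0 on infinite sets, so a positive cardinality gives
    finiteness.\<close>
  have "finite D" using assms by (intro card_ge_0_finite) linarith
  moreover have "b \<noteq> 0" using b by (auto simp: gauss_norm_def)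
  ultimately have "real (card (insert d (insert e D))) \<le> gauss_norm b"
    using d e D b by (intro card_digit_set_le) auto
  then show False using d e \<open>finite D\<close> D by simp
qed

section \<open>Digit expansions from distance to the integers\<close>

definition clear_of_ints :: "real \<Rightarrow> real \<Rightarrow> bool" where
  "clear_of_ints \<delta> t \<longleftrightarrow> (\<forall>p::int. \<delta> \<le> \<bar>t - of_int p\<bar>)"

text \<open>The first two clearances keep \<open>w (Suc n)\<close> at distance
  \<open>2 / cmod b\<close> from the sides of the unit square, more than subtracting
  \<open>w n / b\<close> can move a coordinate, so \<open>r n / b\<close> stays inside. The third
  excludes the digit \<open>d\<close>, and \<open>top\<close> ends the expansion at
  \<open>m\<close>.\<close>

lemma has_digits_if_clear:
  assumes b: "b \<in> gauss_ints" "b \<noteq> 0" and z: "z \<in> gauss_ints"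
    and D: "digit_set b - {d} \<subseteq> D"
    and top: "Re (z / b ^ Suc m) \<in> {0..<1}" "Im (z / b ^ Suc m) \<in> {0..<1}"
    and clear: "\<And>n. n \<le> m \<Longrightarrow> clear_of_ints (2 / cmod b) (Re (z / b ^ Suc n))"
      "\<And>n. n \<le> m \<Longrightarrow> clear_of_ints (2 / cmod b) (Im (z / b ^ Suc n))"
      "\<And>n. n \<le> m \<Longrightarrow> clear_of_ints (2 / cmod b) (Re (z / b ^ Suc n) - Re (d / b))"
  shows "has_digits_in D b z"
proof -
  define q where "q n = Complex (of_int \<lfloor>Re (z / b ^ n)\<rfloor>) (of_int \<lfloor>Im (z / b ^ n)\<rfloor>)" for n
  define w where "w n = z / b ^ n - q n" for n
  define r where "r n = q n - b * q (Suc n)" for n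
  have qG: "q n \<in> gauss_ints" for n by (simp add: q_def gauss_ints_def)
  have q0: "q 0 = z" using z by (auto simp: q_def gauss_ints_def complex_eq_iff elim!: Ints_cases)
  have "\<lfloor>Re (z / b ^ Suc m)\<rfloor> = 0" "\<lfloor>Im (z / b ^ Suc m)\<rfloor> = 0"
    using top by (auto simp: floor_eq_iff)
  then have qm: "q (Suc m) = 0" by (simp add: q_def complex_eq_iff)
  have w_bounds: "0 \<le> Re (w n)" "Re (w n) < 1" "0 \<le> Im (w n)" "Im (w n) < 1" for n
    unfolding w_def q_def by (simp_all add: of_int_floor_le) linarith+
  have small: "\<bar>Re (w n / b)\<bar> < 2 / cmod b" "\<bar>Im (w n / b)\<bar> < 2 / cmod b" for n
  proof -
    have "cmod (w n) \<le> \<bar>Re (w n)\<bar> + \<bar>Im (w n)\<bar>" by (rule cmod_le)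
    then have "cmod (w n) < 2" using w_bounds[of n] by linarith
    then have "cmod (w n / b) < 2 / cmod b" using b by (simp add: norm_divide divide_strict_right_mono)
    then show "\<bar>Re (w n / b)\<bar> < 2 / cmod b" "\<bar>Im (w n / b)\<bar> < 2 / cmod b"
      using abs_Re_le_cmod abs_Im_le_cmod order_le_less_trans by blast+
  qed
  have r_eq: "r n / b = w (Suc n) - w n / b" for n
    using b by (simp add: r_def w_def field_simps)
  have rD: "r n \<in> D" if n: "n \<le> m" for n
  proof -
    define R I where "R = Re (z / b ^ Suc n)" and "I = Im (z / b ^ Suc n)"
    have wR: "Re (w (Suc n)) = R - of_int \<lfloor>R\<rfloor>" and wI: "Im (w (Suc n)) = I - of_int \<lfloor>I\<rfloor>"
      by (simp_all add: w_def q_def R_def I_def)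
    have "2 / cmod b \<le> \<bar>R - of_int \<lfloor>R\<rfloor>\<bar>" "2 / cmod b \<le> \<bar>R - of_int (\<lfloor>R\<rfloor> + 1)\<bar>"
      "2 / cmod b \<le> \<bar>I - of_int \<lfloor>I\<rfloor>\<bar>" "2 / cmod b \<le> \<bar>I - of_int (\<lfloor>I\<rfloor> + 1)\<bar>"
      using clear(1,2)[OF n] unfolding clear_of_ints_def R_def I_def by blast+
    then have "2 / cmod b \<le> Re (w (Suc n))" "Re (w (Suc n)) \<le> 1 - 2 / cmod b"
      "2 / cmod b \<le> Im (w (Suc n))" "Im (w (Suc n)) \<le> 1 - 2 / cmod b"
      using w_bounds[of "Suc n"] unfolding wR wI by auto
    then have "Re (r n / b) \<in> {0..<1}" "Im (r n / b) \<in> {0..<1}"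
      using small[of n] unfolding r_eq by auto
    moreover have "r n \<in> gauss_ints"
      unfolding r_def using qG b by (intro gauss_ints_arith)
    ultimately have "r n \<in> digit_set b" using b by (simp add: digit_set_iff)
    moreover have "r n \<noteq> d"
    proof
      \<comment> \<open>\<open>Re (w n / b)\<close> would be the offset of the third cleared
        quantity from an integer, hence too large for \<open>small\<close>.\<close>
      assume "r n = d"
      then have "Re (w n / b) = R - Re (d / b) - of_int \<lfloor>R\<rfloor>"
        using r_eq[of n] wR by simp
      moreover have "2 / cmod b \<le> \<bar>R - Re (d / b) - of_int \<lfloor>R\<rfloor>\<bar>"
        using clear(3)[OF n] unfolding clear_of_ints_def R_def by blast
      ultimately show False using small(1)[of n] by linarith
    qed
    ultimately show ?thesis using D by blast
  qed
  \<comment> \<open>The sum telescopes between \<open>q 0 = z\<close> and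
    \<open>q (Suc m) = 0\<close>.\<close>
  have "(\<Sum>l=0..m. r l * b ^ l) = (\<Sum>l\<le>m. q l * b ^ l - q (Suc l) * b ^ Suc l)"
    by (intro sum.cong) (auto simp: r_def algebra_simps)
  also have "\<dots> = z"
    using sum_telescope[of "\<lambda>l. q l * b ^ l" m] by (simp add: q0 qm)
  finally show ?thesis
    unfolding has_digits_in_def using rD by (intro exI[of _ m] exI[of _ r]) simp
qed

section \<open>Avoiding strips inside nested discs\<close>

text \<open>One line at a time: the centre moves by 3/4 of the radius away from the line and the
  radius is quartered. The new disc stays in the old one as 3/4 + 1/4 = 1, and its points have
  distance at least 3/4 - 1/4 = 1/2 of the old radius from the line, twice the new radius.\<close>

lemma avoid_strips:
  fixes v :: "'i \<Rightarrow> complex" and s :: "'i \<Rightarrow> real"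
  assumes "finite J" "0 \<le> L"
  shows "\<exists>y. cball y (L / 4 ^ card J) \<subseteq> cball x L \<and>
    (\<forall>i\<in>J. \<forall>z\<in>cball y (L / 4 ^ card J).
      cmod (v i) * (2 * (L / 4 ^ card J)) \<le> \<bar>Re (v i * z) - s i\<bar>)"
  using assms(1)
proof (induction J rule: finite_induct)
  case empty
  show ?case by auto
next
  case (insert i J)
  define r where "r = L / 4 ^ card J"
  have r: "0 \<le> r" using assms by (simp add: r_def)
  have r4: "L / 4 ^ card (insert i J) = r / 4" using insert by (simp add: r_def)
  obtain y where y: "cball y r \<subseteq> cball x L"
    "\<And>i z. i \<in> J \<Longrightarrow> z \<in> cball y r \<Longrightarrow> cmod (v i) * (2 * r) \<le> \<bar>Re (v i * z) - s i\<bar>"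
    using insert.IH unfolding r_def by blast
  define \<sigma> :: real where "\<sigma> = (if s i \<le> Re (v i * y) then 1 else - 1)"
  \<comment> \<open>\<open>cnj (sgn (v i))\<close> is the direction of steepest growth of
    \<open>Re (v i * z)\<close>; \<open>\<sigma>\<close> keeps to the side of the line on which
    \<open>y\<close> lies.\<close>
  define y' where "y' = y + of_real (\<sigma> * (3 / 4) * r) * cnj (sgn (v i))"
  have \<sigma>: "\<bar>\<sigma>\<bar> = 1" by (simp add: \<sigma>_def)
  have "cmod (y' - y) = 3 / 4 * r * cmod (sgn (v i))"
    using r \<sigma> by (simp add: y'_def norm_mult abs_mult)
  also have "\<dots> \<le> 3 / 4 * r" using r by (simp add: norm_sgn)
  finally have "dist y y' \<le> 3 / 4 * r" by (simp add: dist_norm norm_minus_commute)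
  then have sub: "cball y' (r / 4) \<subseteq> cball y r"
    by (subst cball_subset_cball_iff) (auto simp: dist_commute)
  have far: "cmod (v i) * (2 * (r / 4)) \<le> \<bar>Re (v i * z) - s i\<bar>" if z: "z \<in> cball y' (r / 4)" for z
  proof -
    have "\<bar>Re (v i * (z - y'))\<bar> \<le> cmod (v i * (z - y'))" by (rule abs_Re_le_cmod)
    also have "\<dots> \<le> cmod (v i) * (r / 4)"
      unfolding norm_mult using z by (intro mult_left_mono) (auto simp: dist_norm norm_minus_commute)
    finally have "\<bar>Re (v i * (z - y'))\<bar> \<le> cmod (v i) * (r / 4)" .
    moreover have "v i * cnj (sgn (v i)) = of_real (cmod (v i))"
      by (simp add: sgn_div_norm scaleR_conv_of_real complex_norm_square[symmetric] field_simps power2_eq_square)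
    then have "v i * (y' - y) = of_real (\<sigma> * (3 / 4) * r * cmod (v i))"
      by (simp add: y'_def mult.left_commute)
    then have "Re (v i * (y' - y)) = \<sigma> * (3 / 4 * (r * cmod (v i)))"
      by (metis Re_complex_of_real mult.assoc)
    moreover have "Re (v i * z) = Re (v i * y) + Re (v i * (y' - y)) + Re (v i * (z - y'))"
      by (simp add: algebra_simps)
    moreover have "cmod (v i) * (2 * (r / 4)) = r * cmod (v i) / 2" "cmod (v i) * (r / 4) = r * cmod (v i) / 4"
      by simp_all
    moreover have "\<sigma> = 1 \<and> s i \<le> Re (v i * y) \<or> \<sigma> = - 1 \<and> Re (v i * y) < s i"
      by (auto simp: \<sigma>_def)
    ultimately show ?thesis by (elim disjE conjE; simp only:; linarith)
  qed
  show ?case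
    unfolding r4
  proof (intro exI[of _ y'] conjI ballI)
    show "cball y' (r / 4) \<subseteq> cball x L" using sub y by blast
    fix j z assume j: "j \<in> insert i J" and z: "z \<in> cball y' (r / 4)"
    show "cmod (v j) * (2 * (r / 4)) \<le> \<bar>Re (v j * z) - s j\<bar>"
    proof (cases "j = i")
      case False
      have "cmod (v j) * (2 * (r / 4)) \<le> cmod (v j) * (2 * r)"
        using r by (intro mult_left_mono) auto
      also have "\<dots> \<le> \<bar>Re (v j * z) - s j\<bar>" using j False z sub y by blast
      finally show ?thesis .
    qed (use far z in simp)
  qed
qed

lemma one_gap_per_ball:
  fixes x v :: complex and \<tau> :: real
  assumes "cmod v * L \<le> 1 / 4"
  shows "\<exists>s. \<forall>z\<in>cball x L. \<forall>\<delta>\<le>1/4. \<delta> \<le> \<bar>Re (v * z) - s\<bar> \<longrightarrow> clear_of_ints \<delta> (Re (v * z) - \<tau>)"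
proof (intro exI ballI allI impI)
  define a where "a = Re (v * x) - \<tau>"
  \<comment> \<open>The witness is \<open>\<tau> + of_int (round a)\<close>. Every other integer is
    at least 1/2 from \<open>a\<close>, and the disc moves the value by at most 1/4, so those
    integers stay 1/4 away.\<close>
  fix z \<delta> assume z: "z \<in> cball x L" and \<delta>: "\<delta> \<le> 1 / 4" "\<delta> \<le> \<bar>Re (v * z) - (\<tau> + of_int (round a))\<bar>"
  have "\<bar>Re (v * (z - x))\<bar> \<le> cmod (v * (z - x))" by (rule abs_Re_le_cmod)
  also have "\<dots> \<le> cmod v * L"
    unfolding norm_mult using z by (intro mult_left_mono) (auto simp: dist_norm norm_minus_commute)
  also note assms
  finally have close: "\<bar>(Re (v * z) - \<tau>) - a\<bar> \<le> 1 / 4" by (simp add: a_def algebra_simps)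
  show "clear_of_ints \<delta> (Re (v * z) - \<tau>)"
    unfolding clear_of_ints_def
  proof
    fix p :: int
    show "\<delta> \<le> \<bar>Re (v * z) - \<tau> - of_int p\<bar>"
    proof (cases "p = round a")
      case True
      with \<delta> show ?thesis by (simp add: algebra_simps)
    next
      case False
      have "\<bar>of_int (round a) - a\<bar> \<le> 1 / 2" by (rule of_int_round_abs_le)
      moreover have "1 \<le> \<bar>real_of_int p - of_int (round a)\<bar>" using False by linarith
      ultimately show ?thesis using close \<delta> by linarith
    qed
  qed
qed

lemma gauss_int_in_cball:
  assumes "1 \<le> L"
  shows "\<exists>z\<in>gauss_ints. z \<in> cball x L"
proof -
  define z where "z = Complex (of_int (round (Re x))) (of_int (round (Im x)))"
  have "cmod (x - z) \<le> \<bar>Re (x - z)\<bar> + \<bar>Im (x - z)\<bar>" by (rule cmod_le)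
  also have "\<dots> \<le> 1 / 2 + 1 / 2"
    using of_int_round_abs_le[of "Re x"] of_int_round_abs_le[of "Im x"]
    by (intro add_mono) (auto simp: z_def abs_minus_commute)
  finally show ?thesis using assms by (intro bexI[of _ z]) (auto simp: dist_norm z_def gauss_ints_def)
qed

text \<open>Each step of the induction shrinks the radius by \<open>\<rho>\<close>, the total cost
  of \<open>avoid_strips\<close> for one line per index. The rotation \<open>u i\<close> and shift
  \<open>\<tau> i\<close> let one statement cover real parts, imaginary parts and the missing
  digit.\<close>

lemma gauss_int_avoiding_strips:
  fixes b u :: "'i \<Rightarrow> complex" and \<tau> :: "'i \<Rightarrow> real" and \<rho> :: real
  assumes I: "finite I" "I \<noteq> {}" and \<rho>: "\<rho> = 4 ^ card I"
    and u: "\<And>i. i \<in> I \<Longrightarrow> cmod (u i) = 1"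
    and b: "\<And>i. i \<in> I \<Longrightarrow> 4 * \<rho>\<^sup>2 \<le> cmod (b i)"
    and L: "1 \<le> L"
  shows "\<exists>z\<in>gauss_ints. z \<in> cball x L \<and> (\<forall>i\<in>I. \<forall>n. cmod (b i) ^ n \<le> L / \<rho> \<longrightarrow>
    clear_of_ints (2 / cmod (b i)) (Re (u i / b i ^ Suc n * z) - \<tau> i))"
proof -
  have "0 < card I" using I by (simp add: card_gt_0_iff)
  then have "(4::real) ^ 1 \<le> 4 ^ card I" by (intro power_increasing) auto
  then have \<rho>4: "4 \<le> \<rho>" by (simp add: \<rho>)
  then have "\<rho> * 4 \<le> \<rho> * \<rho>" by (intro mult_left_mono) auto
  then have b\<rho>: "16 * \<rho> \<le> cmod (b i)" if "i \<in> I" for i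
    using b[OF that] unfolding power2_eq_square by linarith
  obtain N where "L < \<rho> ^ N" using real_arch_pow[of \<rho> L] \<rho>4 by auto
  then show ?thesis using L
  \<comment> \<open>The case \<open>N = 0\<close> is vacuous since \<open>1 \<le> L\<close>. For
    \<open>L < \<rho>\<close> not even \<open>n = 0\<close> imposes a condition.\<close>
  proof (induction N arbitrary: L x)
    case (Suc N)
    show ?case
    proof (cases "L < \<rho>")
      case True
      obtain z where z: "z \<in> gauss_ints" "z \<in> cball x L" using gauss_int_in_cball Suc.prems by blast
      have "\<not> cmod (b i) ^ n \<le> L / \<rho>" if "i \<in> I" for i n
      proof -
        have "1 \<le> cmod (b i) ^ n" using b\<rho>[OF that] \<rho>4 by (intro one_le_power) linarith
        moreover have "L / \<rho> < 1" using True \<rho>4 by simp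
        ultimately show ?thesis by linarith
      qed
      with z show ?thesis by blast
    next
      case False
      \<comment> \<open>The strips to be avoided in passing from radius \<open>L\<close> to \<open>L / \<rho>\<close>; each \<open>i\<close> has at most one such \<open>n\<close>.\<close>
      define due where "due i n \<longleftrightarrow> cmod (b i) ^ n \<le> L / \<rho> \<and> L / \<rho> < \<rho> * cmod (b i) ^ n" for i n
      \<comment> \<open>The window for \<open>cmod (b i) ^ n\<close> has ratio
        \<open>\<rho>\<close>, while consecutive powers differ by a factor of at least
        \<open>16 * \<rho>\<close>.\<close>
      have due_less: False if "i \<in> I" "due i n" "due i n'" "n < n'" for i n n'
      proof -
        have "1 \<le> cmod (b i)" using b\<rho>[OF that(1)] \<rho>4 by linarith
        then have "cmod (b i) ^ Suc n \<le> cmod (b i) ^ n'" using that by (intro power_increasing) auto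
        moreover have "\<rho> * cmod (b i) ^ n \<le> cmod (b i) * cmod (b i) ^ n"
          using b\<rho>[OF that(1)] \<rho>4 by (intro mult_right_mono) auto
        ultimately show False using that unfolding due_def by simp
      qed
      define \<nu> where "\<nu> i = (SOME n. due i n)" for i
      have \<nu>: "due i (\<nu> i)" "n = \<nu> i" if "i \<in> I" "due i n" for i n
      proof -
        show *: "due i (\<nu> i)" unfolding \<nu>_def using that(2) by (rule someI)
        show "n = \<nu> i" using due_less that * by (cases n "\<nu> i" rule: linorder_cases) blast+
      qed
      define v where "v i = u i / b i ^ Suc (\<nu> i)" for i
      define J where "J = {i\<in>I. due i (\<nu> i)}"
      have v: "cmod (v i) * cmod (b i) ^ \<nu> i = 1 / cmod (b i)" "cmod (v i) * L \<le> 1 / 4"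
        "2 / cmod (b i) \<le> 1 / 4" if "i \<in> J" for i
      proof -
        have i: "i \<in> I" "L / \<rho> < \<rho> * cmod (b i) ^ \<nu> i" using that by (auto simp: J_def due_def)
        have pos: "0 < cmod (b i)" "8 \<le> cmod (b i)" using b\<rho>[OF i(1)] \<rho>4 by linarith+
        then show "cmod (v i) * cmod (b i) ^ \<nu> i = 1 / cmod (b i)" "2 / cmod (b i) \<le> 1 / 4"
          using u[OF i(1)] by (auto simp: v_def norm_divide norm_mult norm_power field_simps)
        \<comment> \<open>Here the bound \<open>4 * \<rho>\<^sup>2 \<le> cmod (b i)\<close> makes
          the strip spacing at least four radii, as \<open>one_gap_per_ball\<close> demands.\<close>
        have "4 * L \<le> 4 * \<rho>\<^sup>2 * cmod (b i) ^ \<nu> i"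
          using i(2) \<rho>4 by (simp add: field_simps power2_eq_square)
        also have "\<dots> \<le> cmod (b i) * cmod (b i) ^ \<nu> i"
          using b[OF i(1)] by (intro mult_right_mono) auto
        finally show "cmod (v i) * L \<le> 1 / 4"
          using u[OF i(1)] pos by (simp add: v_def norm_divide norm_mult norm_power field_simps)
      qed
      obtain s where s: "clear_of_ints \<delta> (Re (v i * z) - \<tau> i)"
        if "i \<in> J" "z \<in> cball x L" "\<delta> \<le> 1 / 4" "\<delta> \<le> \<bar>Re (v i * z) - s i\<bar>" for i z \<delta>
      proof -
        have "\<forall>i\<in>J. \<exists>s. \<forall>z\<in>cball x L. \<forall>\<delta>\<le>1/4.
          \<delta> \<le> \<bar>Re (v i * z) - s\<bar> \<longrightarrow> clear_of_ints \<delta> (Re (v i * z) - \<tau> i)"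
          using v(2) by (intro ballI one_gap_per_ball)
        from bchoice[OF this] show thesis using that by blast
      qed
      \<comment> \<open>Lines are avoided for all of \<open>I\<close>, not just \<open>J\<close>, so
        the radius becomes exactly \<open>L / \<rho>\<close>.\<close>
      obtain y where y: "cball y (L / \<rho>) \<subseteq> cball x L"
        "\<And>i z. i \<in> I \<Longrightarrow> z \<in> cball y (L / \<rho>) \<Longrightarrow> cmod (v i) * (2 * (L / \<rho>)) \<le> \<bar>Re (v i * z) - s i\<bar>"
        using avoid_strips[OF I(1), of L x v s] Suc.prems unfolding \<rho> by auto
      have "L / \<rho> < \<rho> ^ N" "1 \<le> L / \<rho>" using Suc.prems False \<rho>4 by (auto simp: field_simps)
      from Suc.IH[OF this] obtain z where z: "z \<in> gauss_ints" "z \<in> cball y (L / \<rho>)"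
        "\<And>i n. i \<in> I \<Longrightarrow> cmod (b i) ^ n \<le> L / \<rho> / \<rho> \<Longrightarrow>
          clear_of_ints (2 / cmod (b i)) (Re (u i / b i ^ Suc n * z) - \<tau> i)" by blast
      have "clear_of_ints (2 / cmod (b i)) (Re (u i / b i ^ Suc n * z) - \<tau> i)"
        if i: "i \<in> I" and n: "cmod (b i) ^ n \<le> L / \<rho>" for i n
      proof (cases "due i n")
        case True
        then have iJ: "i \<in> J" and n_eq: "n = \<nu> i" using \<nu> i by (auto simp: J_def)
        have "2 / cmod (b i) = cmod (v i) * (2 * cmod (b i) ^ \<nu> i)" using v(1)[OF iJ] by simp
        also have "\<dots> \<le> cmod (v i) * (2 * (L / \<rho>))" using n n_eq by (intro mult_left_mono) auto
        also have "\<dots> \<le> \<bar>Re (v i * z) - s i\<bar>" using y(2)[OF i z(2)] .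
        finally have "clear_of_ints (2 / cmod (b i)) (Re (v i * z) - \<tau> i)"
          using s[OF iJ] v(3)[OF iJ] z(2) y(1) by blast
        then show ?thesis by (simp add: v_def n_eq)
      next
        case False
        \<comment> \<open>Not being due puts the power below the threshold that belongs to the next
          radius.\<close>
        then have "cmod (b i) ^ n \<le> L / \<rho> / \<rho>" using n \<rho>4 by (simp add: due_def field_simps)
        then show ?thesis using z(3) i by blast
      qed
      moreover have "z \<in> cball x L" using z(2) y(1) by (rule subsetD[rotated])
      ultimately show ?thesis using z(1) by (intro bexI[of _ z] conjI ballI allI impI)
    qed
  qed auto
qed

section \<open>Powers of all bases near one real number\<close>

text \<open>In logarithms, some multiple of each \<open>Ln (b j)\<close> must be close to a common
  real \<open>T\<close> modulo 2 pi i. This asks that multiples of 2k real numbers, for moduli and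
  arguments, be near integers at once, which Dirichlet's theorem supplies.\<close>

lemma simultaneous_powers:
  fixes b :: "nat \<Rightarrow> complex" and \<epsilon> X0 :: real
  assumes b: "\<And>j. j < k \<Longrightarrow> 1 < cmod (b j)" and \<epsilon>: "0 < \<epsilon>"
  obtains X m where "X0 \<le> X" "0 < X" "\<And>j. j < k \<Longrightarrow> cmod (b j ^ Suc (m j) / of_real X - 1) < \<epsilon>"
proof -
  define \<kappa> \<alpha> where "\<kappa> j = ln (cmod (b j))" and "\<alpha> j = Im (Ln (b j))" for j
  have \<kappa>: "0 < \<kappa> j" if "j < k" for j using b[OF that] by (simp add: \<kappa>_def ln_gt_zero)
  have Ln_b: "Ln (b j) = Complex (\<kappa> j) (\<alpha> j)" "exp (Ln (b j)) = b j" if "j < k" for j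
  proof -
    have "b j \<noteq> 0" using b[OF that] by auto
    then show "Ln (b j) = Complex (\<kappa> j) (\<alpha> j)" "exp (Ln (b j)) = b j"
      by (auto simp: \<kappa>_def \<alpha>_def Re_Ln intro: complex_eqI)
  qed
  obtain \<eta> :: real where \<eta>: "0 < \<eta>" "\<And>w::complex. cmod w < \<eta> \<Longrightarrow> cmod (exp w - 1) < \<epsilon>"
  proof -
    have "isCont exp (0::complex)" by simp
    then obtain d where "0 < d" "\<forall>w::complex. dist w 0 < d \<longrightarrow> dist (exp w) (exp 0) < \<epsilon>"
      using \<epsilon> unfolding continuous_at_eps_delta by blast
    then show thesis using that[of d] by (auto simp: dist_norm)
  qed
  have nonneg: "0 \<le> \<kappa> j" "0 \<le> \<kappa> j + \<bar>\<alpha> j\<bar>" if "j < k" for j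
    using \<kappa>[OF that] by auto
  \<comment> \<open>\<open>C / N\<close> will bound the error in the logarithm, for all
    \<open>j\<close> at once.\<close>
  define C where "C = (\<Sum>j<k. \<kappa> j + \<bar>\<alpha> j\<bar>) + 2 * pi"
  have C: "\<kappa> j + \<bar>\<alpha> j\<bar> + 2 * pi \<le> C" if "j < k" for j
    unfolding C_def using that nonneg
    by (intro add_right_mono member_le_sum[of j "{..<k}" "\<lambda>j. \<kappa> j + \<bar>\<alpha> j\<bar>"]) auto
  have C_pos: "0 < C"
    unfolding C_def using nonneg by (intro add_nonneg_pos sum_nonneg) auto
  obtain N :: nat where N: "0 < N" "C / N < \<eta>"
  proof -
    obtain N :: nat where "C / \<eta> < N" using reals_Archimedean2 by blast
    moreover have "0 < C / \<eta>" using C_pos \<eta> by simp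
    ultimately have "0 < real N" by linarith
    moreover from this have "C / N < \<eta>" using \<open>C / \<eta> < N\<close> \<eta>(1) by (simp add: field_simps)
    ultimately show thesis using that by simp
  qed
  \<comment> \<open>\<open>X0 \<le> K\<close> makes \<open>exp T\<close> large enough;
    \<open>\<kappa> j \<le> K\<close> gives \<open>1 \<le> T / \<kappa> j\<close>, so every exponent
    \<open>p j\<close> is positive.\<close>
  define K where "K = \<bar>X0\<bar> + (\<Sum>j<k. \<kappa> j)"
  have K: "\<kappa> j \<le> K" if "j < k" for j
  proof -
    have "\<kappa> j \<le> (\<Sum>j<k. \<kappa> j)" using that nonneg by (intro member_le_sum) auto
    then show ?thesis by (simp add: K_def)
  qed
  have K0: "X0 \<le> K" "0 \<le> K"
  proof -
    have "0 \<le> (\<Sum>j<k. \<kappa> j)" using nonneg by (intro sum_nonneg) auto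
    then show "X0 \<le> K" "0 \<le> K" by (auto simp: K_def)
  qed
  define \<theta> where "\<theta> i = (if i < k then K / \<kappa> i else K * \<alpha> (i - k) / (2 * pi * \<kappa> (i - k)))" for i
  obtain q p where q: "0 < q" and qp: "\<And>i. i < 2 * k \<Longrightarrow> \<bar>of_int q * \<theta> i - of_int (p i)\<bar> < 1 / N"
    using Dirichlet_approx_simult[OF N(1), of "2 * k" \<theta>] by metis
  define T where "T = of_int q * K"
  have "1 \<le> real_of_int q" using q by simp
  then have KT: "K \<le> T" unfolding T_def using K0 mult_right_mono[of 1 "real_of_int q" K] by simp
  have main: "cmod (b j ^ nat (p j) / of_real (exp T) - 1) < \<epsilon> \<and> 0 < nat (p j)" if j: "j < k" for j
  proof -
    have l: "0 < \<kappa> j" using \<kappa> j by blast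
    define x y where "x = of_int (p j) - T / \<kappa> j" and "y = of_int (p (k + j)) - T * \<alpha> j / (2 * pi * \<kappa> j)"
    have x: "\<bar>x\<bar> < 1 / N" and y: "\<bar>y\<bar> < 1 / N"
      using qp[of j] qp[of "k + j"] j by (auto simp: \<theta>_def x_def y_def T_def abs_minus_commute)
    have "1 \<le> T / \<kappa> j" using K[OF j] KT l by (simp add: field_simps)
    moreover have "1 / N \<le> 1" using N by simp
    ultimately have pj: "0 < p j" using x unfolding x_def by linarith
    \<comment> \<open>\<open>w\<close> is the logarithm of \<open>b j ^ nat (p j) / exp T\<close>
      after removing full turns.\<close>
    define w where "w = Complex (x * \<kappa> j) (x * \<alpha> j - 2 * pi * y)"
    have "w = of_nat (nat (p j)) * Ln (b j) - of_real T - \<i> * of_int (2 * p (k + j)) * of_real pi"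
      using pj l by (simp add: w_def x_def y_def complex_eq_iff Ln_b(1)[OF j] field_simps)
    moreover have "exp (\<i> * of_int (2 * p (k + j)) * of_real pi) = 1"
      using exp_integer_2pi[of "of_int (p (k + j))"] by (simp add: mult_ac)
    ultimately have "exp w = b j ^ nat (p j) / of_real (exp T)"
      using Ln_b(2)[OF j] by (simp add: exp_diff exp_of_nat_mult exp_of_real)
    moreover have "cmod w < \<eta>"
    proof -
      have "cmod w \<le> \<bar>Re w\<bar> + \<bar>Im w\<bar>" by (rule cmod_le)
      also have "\<dots> \<le> \<bar>x\<bar> * \<kappa> j + (\<bar>x\<bar> * \<bar>\<alpha> j\<bar> + 2 * pi * \<bar>y\<bar>)"
        using l abs_triangle_ineq4[of "x * \<alpha> j" "2 * pi * y"] by (simp add: w_def abs_mult)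
      also have "\<dots> \<le> 1 / N * \<kappa> j + (1 / N * \<bar>\<alpha> j\<bar> + 2 * pi * (1 / N))"
        using x y l by (intro add_mono mult_mono) auto
      also have "\<dots> = (\<kappa> j + \<bar>\<alpha> j\<bar> + 2 * pi) / N" by (simp add: add_divide_distrib)
      also have "\<dots> \<le> C / N" using C[OF j] by (intro divide_right_mono) auto
      finally show ?thesis using N by linarith
    qed
    ultimately show ?thesis using \<eta>(2)[of w] pj by simp
  qed
  show thesis
  proof (rule that)
    show "X0 \<le> exp T" using exp_ge_add_one_self[of T] KT K0 by linarith
    show "cmod (b j ^ Suc (nat (p j) - 1) / of_real (exp T) - 1) < \<epsilon>" if "j < k" for j
      using main[OF that] by simp
  qed simp
qed

section \<open>Choice of constants and conclusion\<close>

theorem theorem4p2: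
  fixes k :: nat
  assumes "k \<ge> 2"
  shows "\<exists>M::real. M > 0 \<and>
    (\<forall>(b :: nat \<Rightarrow> complex) (D :: nat \<Rightarrow> complex set).
       inj_on b {1..k} \<longrightarrow>
       (\<forall>j\<in>{1..k}. b j \<in> gauss_ints \<and> gauss_norm (b j) \<ge> M) \<longrightarrow>
       (\<forall>j\<in>{1..k}. D j \<subseteq> digit_set (b j) \<and> real (card (D j)) = gauss_norm (b j) - 1) \<longrightarrow>
       (\<exists>B. finite B \<and> B \<subseteq> gauss_ints \<and>
          infinite {z \<in> gauss_ints. \<forall>j\<in>{1..k}. \<exists>s\<in>B. has_digits_in (D j) (b j) (z + s)}))"
proof -
  \<comment> \<open>There are three strip families per base, hence \<open>k * 3\<close> lines per
    step.\<close>
  define \<rho> :: real where "\<rho> = 4 ^ (k * 3)"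
  have "(4::real) ^ 3 \<le> 4 ^ (k * 3)" using assms by (intro power_increasing) auto
  then have \<rho>64: "64 \<le> \<rho>" by (simp add: \<rho>_def)
  show ?thesis
  proof (intro exI[of _ "(4 * \<rho>\<^sup>2)\<^sup>2"] conjI allI impI)
    show "0 < (4 * \<rho>\<^sup>2)\<^sup>2" using \<rho>64 by simp
    fix b D
    assume b: "\<forall>j\<in>{1..k}. b j \<in> gauss_ints \<and> (4 * \<rho>\<^sup>2)\<^sup>2 \<le> gauss_norm (b j)"
      and D: "\<forall>j\<in>{1..k}. D j \<subseteq> digit_set (b j) \<and> real (card (D j)) = gauss_norm (b j) - 1"
    have b_large: "4 * \<rho>\<^sup>2 \<le> cmod (b j)" if "j \<in> {1..k}" for j
      using b that by (auto simp: gauss_norm_def intro: power2_le_imp_le)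
    have "10 * \<rho> \<le> 4 * \<rho>\<^sup>2" using \<rho>64 mult_right_mono[of 64 \<rho> \<rho>] by (simp add: power2_eq_square)
    then have b10: "10 * \<rho> \<le> cmod (b j)" if "j \<in> {1..k}" for j
      using b_large[OF that] by linarith
    then have b1: "1 < cmod (b j)" if "j \<in> {1..k}" for j
      using b10[OF that] \<rho>64 by linarith
    have "\<forall>j\<in>{1..k}. \<exists>d. digit_set (b j) - {d} \<subseteq> D j"
      using b D b1 by (intro ballI missing_digit) (auto simp: gauss_norm_def one_less_power)
    then obtain d where d: "\<And>j. j \<in> {1..k} \<Longrightarrow> digit_set (b j) - {d j} \<subseteq> D j"
      by metis
    let ?S = "{z \<in> gauss_ints. \<forall>j\<in>{1..k}. has_digits_in (D j) (b j) z}"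
    have large: "\<exists>z\<in>?S. X0 \<le> cmod z" for X0
    proof -
      \<comment> \<open>The bound on \<open>X\<close> yields both \<open>1 \<le> X / 8\<close> and
        \<open>X0 \<le> 3/8 * X\<close>, the latter bounding \<open>Re z\<close> below.\<close>
      obtain X m where X: "3 * \<bar>X0\<bar> + 8 \<le> X" "0 < X"
        and m: "\<And>j. j < k \<Longrightarrow> cmod (b (Suc j) ^ Suc (m j) / of_real X - 1) < 1 / 4"
        using simultaneous_powers[of k "\<lambda>j. b (Suc j)" "1 / 4" "3 * \<bar>X0\<bar> + 8"] b1 by auto
      define I where "I = {1..k} \<times> {0..<3::nat}"
      \<comment> \<open>Index \<open>c\<close> selects real part (0), imaginary part (1, as
        \<open>Re (- \<i> * w) = Im w\<close>) or real part shifted by the missing digit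
        (2).\<close>
      define u :: "nat \<times> nat \<Rightarrow> complex" where "u = (\<lambda>(j, c). if c = 1 then - \<i> else 1)"
      define \<tau> where "\<tau> = (\<lambda>(j, c::nat). if c = 2 then Re (d j / b j) else 0)"
      have card_I: "card I = k * 3" by (simp add: I_def)
      have "finite I" "I \<noteq> {}" using assms by (auto simp: I_def)
      have u: "cmod (u i) = 1" for i by (auto simp: u_def split: prod.splits)
      have bI: "4 * \<rho>\<^sup>2 \<le> cmod (b (fst i))" if "i \<in> I" for i
        using that b_large by (auto simp: I_def)
      have \<rho>_eq: "\<rho> = 4 ^ card I" by (simp add: card_I \<rho>_def)
      have "1 \<le> X / 8" using X by linarith
      from gauss_int_avoiding_strips[where u = u and b = "\<lambda>i. b (fst i)" and \<tau> = \<tau>,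
          OF \<open>finite I\<close> \<open>I \<noteq> {}\<close> \<rho>_eq u bI this]
      obtain z where z: "z \<in> gauss_ints" "z \<in> cball (of_real X * Complex (1/2) (1/2)) (X / 8)"
        and clear: "\<And>i n. i \<in> I \<Longrightarrow> cmod (b (fst i)) ^ n \<le> X / 8 / \<rho> \<Longrightarrow>
          clear_of_ints (2 / cmod (b (fst i))) (Re (u i / b (fst i) ^ Suc n * z) - \<tau> i)"
        by metis
      define e where "e = z / of_real X - Complex (1/2) (1/2)"
      have z_eq: "z = of_real X * (Complex (1/2) (1/2) + e)" using X by (simp add: e_def)
      have "cmod (of_real X * e) \<le> X / 8"
        using z(2) by (simp add: z_eq dist_norm algebra_simps)
      then have e: "cmod e \<le> 1 / 8" using X by (simp add: norm_mult)
      have "has_digits_in (D j) (b j) z" if j: "j \<in> {1..k}" for j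
      proof -
        define m' where "m' = m (j - 1)"
        have bj: "b j \<in> gauss_ints" "b j \<noteq> 0" using b b1 j by force+
        define a where "a = b j ^ Suc m' / of_real X"
        have a: "cmod (a - 1) < 1 / 4" using m[of "j - 1"] j by (auto simp: a_def m'_def)
        have a_bounds: "3 / 4 < cmod a" "cmod a < 5 / 4"
          using a norm_triangle_ineq2[of a 1] norm_triangle_ineq2[of 1 a] by (auto simp: norm_minus_commute)
        then have "a \<noteq> 0" by auto
        have "z / b j ^ Suc m' = (Complex (1/2) (1/2) + e) / a"
          using bj X by (simp add: z_eq a_def)
        also have "\<dots> = Complex (1/2) (1/2) + (e - Complex (1/2) (1/2) * (a - 1)) / a"
          using \<open>a \<noteq> 0\<close> by (simp add: field_simps)
        finally have top: "z / b j ^ Suc m' = Complex (1/2) (1/2) + (e - Complex (1/2) (1/2) * (a - 1)) / a" .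
        have "cmod (Complex (1/2) (1/2)) \<le> 1"
          using cmod_le[of "Complex (1/2) (1/2)"] by simp
        then have "cmod (Complex (1/2) (1/2) * (a - 1)) \<le> 1 * (1 / 4)"
          unfolding norm_mult using a by (intro mult_mono) auto
        \<comment> \<open>The total error 1/8 + 1/4 is half of 3/4, hence below half of
          \<open>cmod a\<close>: \<open>z / b j ^ Suc m'\<close> stays in the unit square.\<close>
        then have "cmod (e - Complex (1/2) (1/2) * (a - 1)) \<le> 1 / 8 + 1 / 4"
          using e norm_triangle_ineq4[of e "Complex (1/2) (1/2) * (a - 1)"] by linarith
        also have "\<dots> < 1 / 2 * cmod a" using a_bounds by linarith
        finally have "cmod (z / b j ^ Suc m' - Complex (1/2) (1/2)) < 1 / 2"
          unfolding top using \<open>a \<noteq> 0\<close> by (simp add: norm_divide field_simps)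
        then have "\<bar>Re (z / b j ^ Suc m') - 1 / 2\<bar> < 1 / 2" "\<bar>Im (z / b j ^ Suc m') - 1 / 2\<bar> < 1 / 2"
          using abs_Re_le_cmod[of "z / b j ^ Suc m' - Complex (1/2) (1/2)"]
            abs_Im_le_cmod[of "z / b j ^ Suc m' - Complex (1/2) (1/2)"]
          by (simp_all del: power_Suc)
        then have sq: "Re (z / b j ^ Suc m') \<in> {0..<1}" "Im (z / b j ^ Suc m') \<in> {0..<1}"
          by (simp_all add: abs_if split: if_splits)
        \<comment> \<open>The factor 10 is 8 times 5/4, for the radius \<open>X / 8\<close> and the
          bound on \<open>cmod a\<close>.\<close>
        have small: "cmod (b j) ^ n \<le> X / 8 / \<rho>" if "n \<le> m'" for n
        proof -
          have "10 * \<rho> * cmod (b j) ^ n \<le> cmod (b j) * cmod (b j) ^ m'"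
            using b10[OF j] b1[OF j] that \<rho>64 by (intro mult_mono power_increasing) auto
          also have "\<dots> = X * cmod a" using X by (simp add: a_def norm_divide norm_mult norm_power)
          also have "\<dots> \<le> X * (5 / 4)" using a_bounds X by (intro mult_left_mono) auto
          finally show ?thesis using \<rho>64 by (simp add: field_simps)
        qed
        show ?thesis
        proof (rule has_digits_if_clear[OF bj z(1) d[OF j] sq])
          fix n assume "n \<le> m'"
          show "clear_of_ints (2 / cmod (b j)) (Re (z / b j ^ Suc n))"
            using clear[of "(j, 0)" n] small[OF \<open>n \<le> m'\<close>] j by (simp add: I_def u_def \<tau>_def)
          show "clear_of_ints (2 / cmod (b j)) (Re (z / b j ^ Suc n) - Re (d j / b j))"
            using clear[of "(j, 2)" n] small[OF \<open>n \<le> m'\<close>] j by (simp add: I_def u_def \<tau>_def)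
          have "- \<i> / b j ^ Suc n * z = - (\<i> * (z / b j ^ Suc n))" by simp
          then have "Im (z / b j ^ Suc n) = Re (- \<i> / b j ^ Suc n * z)"
            by (simp only: uminus_complex.sel Re_i_times minus_minus)
          then show "clear_of_ints (2 / cmod (b j)) (Im (z / b j ^ Suc n))"
            using clear[of "(j, 1)" n] small[OF \<open>n \<le> m'\<close>] j by (simp add: I_def u_def \<tau>_def)
        qed
      qed
      moreover have "X0 \<le> cmod z"
      proof -
        have "\<bar>Re e\<bar> \<le> 1 / 8" using e abs_Re_le_cmod[of e] by linarith
        have "X0 \<le> X * (1 / 2 + Re e)"
        proof -
          have "X0 \<le> X * (3/8)" using X by auto
          also have "\<dots> \<le> X * (1 / 2 + Re e)" using X \<open>\<bar>Re e\<bar> \<le> 1 / 8\<close> by (intro mult_left_mono) auto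
          finally show ?thesis .
        qed
        also have "\<dots> = Re z" by (simp add: z_eq)
        also have "\<dots> \<le> cmod z" by (rule complex_Re_le_cmod)
        finally show ?thesis .
      qed
      ultimately show ?thesis using z(1) by blast
    qed
    have "\<not> bounded ?S"
    proof
      assume "bounded ?S"
      then obtain a where a: "\<And>z. z \<in> ?S \<Longrightarrow> cmod z \<le> a" unfolding bounded_iff by blast
      obtain z where "z \<in> ?S" "a + 1 \<le> cmod z" using large by blast
      with a[of z] show False by linarith
    qed
    then have "infinite ?S" using finite_imp_bounded by blast
    then show "\<exists>B. finite B \<and> B \<subseteq> gauss_ints \<and>
      infinite {z \<in> gauss_ints. \<forall>j\<in>{1..k}. \<exists>s\<in>B. has_digits_in (D j) (b j) (z + s)}"
      by (intro exI[of _ "{0}"]) (auto simp: gauss_ints_def)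
  qed
qed

end
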